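(* If $\mathcal{G}$ and $\mathcal{G}'$ are dags over the same finite set of discrete variables and $\mathcal{G}\approx\mathcal{G}'$, then $\mathrm{Dim}(\mathcal{G})=\mathrm{Dim}(\mathcal{G}')$.
   Context: All graphs have the same finite vertex set $U=\{x_1,\dots,x_n\}$; a dag is an acyclic directed graph on $U$. Each node $x_i$ is a discrete variable with a finite number $r_i\ge 2$ of states. $\Pi_i^{\mathcal{G}}$ denotes the set of parents of $x_i$ in $\mathcal{G}$. A Bayesian network with structure $\mathcal{G}$ is a pair $(\mathcal{G},\theta_{\mathcal{G}})$ where $\theta_{\mathcal{G}}$ is a collection of conditional distributions $p(x_i\mid\Pi_i^{\mathcal{G}})$; it defines the joint distribution $\prod_i p(x_i\mid\Pi_i^{\mathcal{G}})$. Two dags are equivalent, written $\mathcal{G}\approx\mathcal{G}'$, if for every Bayesian network $(\mathcal{G},\theta_{\mathcal{G}})$ there is a Bayesian network $(\mathcal{G}',\theta_{\mathcal{G}'})$ defining the same joint distribution, and vice versa. Known fact (Verma and Pearl): $\mathcal{G}\approx\mathcal{G}'$ if and only if they have the same skeleton (underlying undirected graph) and the same v-structures (ordered triples $(x,y,z)$ of distinct nodes with $x\to y$, $z\to y$ and $x,z$ not adjacent). The number of parameters is $\mathrm{Dim}(\mathcal{G})=\sum_{i=1}^n \mathrm{Dim}(x_i,\Pi_i^{\mathcal{G}})$, where $\mathrm{Dim}(x_i,\Pi_i^{\mathcal{G}})=(r_i-1)\prod_{x_j\in\Pi_i^{\mathcal{G}}}r_j$. *)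

theory Defs
  imports "HOL-Probability.Probability_Mass_Function"
begin

text \<open>Directed graphs on a vertex set \<open>U\<close> are edge relations; \<open>(x, y) \<in> G\<close> is the edge
  \<open>x \<rightarrow> y\<close>. The vertices are the discrete variables, and \<open>S x\<close> is the set of states of \<open>x\<close>,
  so that \<open>r\<^sub>x = card (S x)\<close>.\<close>

definition dag :: "'v set \<Rightarrow> ('v \<times> 'v) set \<Rightarrow> bool" where
  "dag U G \<longleftrightarrow> G \<subseteq> U \<times> U \<and> acyclic G"

definition parents :: "('v \<times> 'v) set \<Rightarrow> 'v \<Rightarrow> 'v set" where
  "parents G x = {y. (y, x) \<in> G}"

text \<open>Joint state assignments of a set \<open>V\<close> of variables are the elements of
  \<open>Pi\<^sub>E V S\<close>. The parameter \<open>\<theta> x c\<close> is the conditional distribution of \<open>x\<close> given that its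
  parents are in the joint state \<open>c\<close>. It is specified for every \<open>c\<close>, including those that
  have probability 0; values of \<open>\<theta>\<close> at other arguments are irrelevant.\<close>

definition bayes_net ::
  "'v set \<Rightarrow> ('v \<Rightarrow> 's set) \<Rightarrow> ('v \<times> 'v) set \<Rightarrow> ('v \<Rightarrow> ('v \<Rightarrow> 's) \<Rightarrow> 's pmf) \<Rightarrow> bool" where
  "bayes_net U S G \<theta> \<longleftrightarrow>
     dag U G \<and> (\<forall>x\<in>U. \<forall>c\<in>Pi\<^sub>E (parents G x) S. set_pmf (\<theta> x c) \<subseteq> S x)"

definition joint ::
  "'v set \<Rightarrow> ('v \<times> 'v) set \<Rightarrow> ('v \<Rightarrow> ('v \<Rightarrow> 's) \<Rightarrow> 's pmf) \<Rightarrow> ('v \<Rightarrow> 's) \<Rightarrow> real" where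
  "joint U G \<theta> u = (\<Prod>x\<in>U. pmf (\<theta> x (restrict u (parents G x))) (u x))"

definition dag_equiv ::
  "'v set \<Rightarrow> ('v \<Rightarrow> 's set) \<Rightarrow> ('v \<times> 'v) set \<Rightarrow> ('v \<times> 'v) set \<Rightarrow> bool" where
  "dag_equiv U S G G' \<longleftrightarrow>
     (\<forall>\<theta>. bayes_net U S G \<theta> \<longrightarrow>
        (\<exists>\<theta>'. bayes_net U S G' \<theta>' \<and> (\<forall>u\<in>Pi\<^sub>E U S. joint U G \<theta> u = joint U G' \<theta>' u))) \<and>
     (\<forall>\<theta>'. bayes_net U S G' \<theta>' \<longrightarrow>
        (\<exists>\<theta>. bayes_net U S G \<theta> \<and> (\<forall>u\<in>Pi\<^sub>E U S. joint U G \<theta> u = joint U G' \<theta>' u)))"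

definition node_dim :: "('v \<Rightarrow> 's set) \<Rightarrow> 'v \<Rightarrow> 'v set \<Rightarrow> nat" where
  "node_dim S x P = (card (S x) - 1) * (\<Prod>y\<in>P. card (S y))"

definition net_dim :: "'v set \<Rightarrow> ('v \<Rightarrow> 's set) \<Rightarrow> ('v \<times> 'v) set \<Rightarrow> nat" where
  "net_dim U S G = (\<Sum>x\<in>U. node_dim S x (parents G x))"

end

theory Submission
  imports Defs "HOL-Homology.Invariance_of_Domain"
begin

text \<open>The strictly positive distributions defined by Bayesian networks with structure \<open>G\<close> form
  a topological space that only depends on the equivalence class of \<open>G\<close>. The log-odds of all
  conditional distributions, relative to one reference state per variable, are global coordinates
  on this space. Their inverse is the softmax function; they are continuous because a conditional
  distribution can be read off the marginal on a node and its ancestors, which factorises along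
  \<open>G\<close>. There are \<open>Dim(G)\<close> coordinates, so the space is homeomorphic to Euclidean space of
  dimension \<open>Dim(G)\<close>, and invariance of dimension concludes.\<close>

section \<open>Powers of a space and Euclidean space\<close>

lemma homeomorphic_product_topology_reindex:
  assumes "bij_betw h J I"
  shows "product_topology (\<lambda>_. X) I homeomorphic_space product_topology (\<lambda>_. X) J"
proof -
  have hJ: "h j \<in> I" if "j \<in> J" for j
    using assms that by (auto simp: bij_betw_def)
  have gI: "inv_into J h i \<in> J" if "i \<in> I" for i
    using assms that by (metis bij_betw_imp_surj_on inv_into_into)
  \<comment> \<open>The maps are precomposition with \<open>h\<close> and with its inverse. Every
    component of either map is a projection, which gives continuity.\<close>
  have "homeomorphic_maps (product_topology (\<lambda>_. X) I) (product_topology (\<lambda>_. X) J)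
      (\<lambda>f. \<lambda>j\<in>J. f (h j)) (\<lambda>f. \<lambda>i\<in>I. f (inv_into J h i))"
    unfolding homeomorphic_maps_def
  proof (intro conjI ballI)
    show "continuous_map (product_topology (\<lambda>_. X) I) (product_topology (\<lambda>_. X) J)
        (\<lambda>f. \<lambda>j\<in>J. f (h j))"
      using continuous_map_product_projection[of _ I "\<lambda>_. X"]
      by (auto simp: continuous_map_componentwise hJ)
    show "continuous_map (product_topology (\<lambda>_. X) J) (product_topology (\<lambda>_. X) I)
        (\<lambda>f. \<lambda>i\<in>I. f (inv_into J h i))"
      using continuous_map_product_projection[of _ J "\<lambda>_. X"]
      by (auto simp: continuous_map_componentwise gI)
  next
    fix f assume "f \<in> topspace (product_topology (\<lambda>_. X) I)"
    then show "(\<lambda>i\<in>I. (\<lambda>j\<in>J. f (h j)) (inv_into J h i)) = f"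
      using gI bij_betw_inv_into_right[OF assms] by (auto simp: fun_eq_iff PiE_def extensional_def)
  next
    fix f assume "f \<in> topspace (product_topology (\<lambda>_. X) J)"
    then show "(\<lambda>j\<in>J. (\<lambda>i\<in>I. f (inv_into J h i)) (h j)) = f"
      using hJ bij_betw_inv_into_left[OF assms] by (auto simp: fun_eq_iff PiE_def extensional_def)
  qed
  then show ?thesis
    by (auto simp: homeomorphic_space_def)
qed

lemma homeomorphic_powertop_real_Euclidean_space:
  assumes "finite I"
  shows "powertop_real I homeomorphic_space Euclidean_space (card I)"
proof -
  obtain h where "bij_betw h {..<card I} I"
    using ex_bij_betw_nat_finite[OF assms] by (auto simp: atLeast0LessThan)
  then show ?thesis
    using homeomorphic_product_topology_reindex homeomorphic_Euclidean_space_product_topology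
      homeomorphic_space_sym homeomorphic_space_trans by blast
qed

section \<open>Marginals and strictly positive laws\<close>

definition marginal ::
  "'v set \<Rightarrow> ('v \<Rightarrow> 's set) \<Rightarrow> (('v \<Rightarrow> 's) \<Rightarrow> real) \<Rightarrow> 'v set \<Rightarrow> ('v \<Rightarrow> 's) \<Rightarrow> real" where
  "marginal U S p A w = (\<Sum>u\<in>{u \<in> Pi\<^sub>E U S. restrict u A = w}. p u)"

text \<open>Positivity makes all logarithms below meaningful. The restriction turns laws into points
  of \<open>powertop_real (Pi\<^sub>E U S)\<close> and identifies joint functions that agree on
  assignments, which is the agreement that \<open>dag_equiv\<close> speaks of.\<close>

definition positive_laws ::
  "'v set \<Rightarrow> ('v \<Rightarrow> 's set) \<Rightarrow> ('v \<times> 'v) set \<Rightarrow> (('v \<Rightarrow> 's) \<Rightarrow> real) set" where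
  "positive_laws U S G =
     {restrict (joint U G \<theta>) (Pi\<^sub>E U S) | \<theta>.
        bayes_net U S G \<theta> \<and> (\<forall>u\<in>Pi\<^sub>E U S. 0 < joint U G \<theta> u)}"

text \<open>Equivalence of the dags enters the proof only here. Parameters for one dag are replaced
  by parameters for the other with the same joint values, so positivity carries over.\<close>

lemma dag_equiv_positive_laws:
  assumes "dag_equiv U S G G'"
  shows "positive_laws U S G = positive_laws U S G'"
proof
  show "positive_laws U S G \<subseteq> positive_laws U S G'"
  proof
    fix p assume "p \<in> positive_laws U S G"
    then obtain \<theta> where \<theta>: "p = restrict (joint U G \<theta>) (Pi\<^sub>E U S)" "bayes_net U S G \<theta>"
      "\<forall>u\<in>Pi\<^sub>E U S. 0 < joint U G \<theta> u"
      by (auto simp: positive_laws_def)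
    with assms obtain \<theta>' where
      "bayes_net U S G' \<theta>'" "\<forall>u\<in>Pi\<^sub>E U S. joint U G \<theta> u = joint U G' \<theta>' u"
      by (auto simp: dag_equiv_def)
    with \<theta> show "p \<in> positive_laws U S G'"
      unfolding positive_laws_def by (auto intro!: exI[of _ \<theta>'])
  qed
  show "positive_laws U S G' \<subseteq> positive_laws U S G"
  proof
    fix p assume "p \<in> positive_laws U S G'"
    then obtain \<theta> where \<theta>: "p = restrict (joint U G' \<theta>) (Pi\<^sub>E U S)" "bayes_net U S G' \<theta>"
      "\<forall>u\<in>Pi\<^sub>E U S. 0 < joint U G' \<theta> u"
      by (auto simp: positive_laws_def)
    with assms obtain \<theta>' where
      "bayes_net U S G \<theta>'" "\<forall>u\<in>Pi\<^sub>E U S. joint U G \<theta>' u = joint U G' \<theta> u"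
      by (auto simp: dag_equiv_def)
    with \<theta> show "p \<in> positive_laws U S G"
      unfolding positive_laws_def by (auto intro!: exI[of _ \<theta>'])
  qed
qed

section \<open>Factorisation of marginals on parent-closed sets\<close>

locale finite_state_dag =
  fixes U :: "'v set" and S :: "'v \<Rightarrow> 's set" and G :: "('v \<times> 'v) set"
  assumes finite_nodes: "finite U"
    and finite_states: "x \<in> U \<Longrightarrow> finite (S x)"
    and states_nonempty: "x \<in> U \<Longrightarrow> S x \<noteq> {}"
    and dag: "dag U G"
begin

lemma parents_subset: "parents G x \<subseteq> U"
  using dag by (auto simp: dag_def parents_def)

lemma finite_assignments: "finite (Pi\<^sub>E U S)"
  by (intro finite_PiE finite_nodes finite_states)

lemma bayes_net_iff:
  "bayes_net U S G \<theta> \<longleftrightarrow> (\<forall>x\<in>U. \<forall>c\<in>Pi\<^sub>E (parents G x) S. set_pmf (\<theta> x c) \<subseteq> S x)"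
  by (simp add: bayes_net_def dag)

lemma sum_bayes_net:
  assumes "bayes_net U S G \<theta>" "x \<in> U" "c \<in> Pi\<^sub>E (parents G x) S"
  shows "(\<Sum>s\<in>S x. pmf (\<theta> x c) s) = 1"
  using assms finite_states by (intro sum_pmf_eq_1) (auto simp: bayes_net_iff)

text \<open>If \<open>A\<close> is closed under parents, the factors of the nodes in
  \<open>A\<close> read no value outside \<open>A\<close>. Hence \<open>joint A G \<theta>\<close>
  makes sense as a partial product.\<close>

lemma joint_cong_parents:
  assumes "\<And>y. y \<in> A \<Longrightarrow> parents G y \<subseteq> A" "\<And>y. y \<in> A \<Longrightarrow> u y = w y"
  shows "joint A G \<theta> u = joint A G \<theta> w"
  unfolding joint_def
proof (intro prod.cong refl)
  fix y assume y: "y \<in> A"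
  then have "restrict u (parents G y) = restrict w (parents G y)"
    using assms by (intro restrict_ext) blast
  with y assms(2) show "pmf (\<theta> y (restrict u (parents G y))) (u y) =
      pmf (\<theta> y (restrict w (parents G y))) (w y)"
    by simp
qed

text \<open>No factor over \<open>A\<close> reads the value at \<open>x\<close>, so changing that
  value affects only the new factor.\<close>

lemma joint_insert:
  assumes "A \<subseteq> U" "\<And>y. y \<in> A \<Longrightarrow> parents G y \<subseteq> A" "x \<notin> A" "parents G x \<subseteq> A"
  shows "joint (insert x A) G \<theta> (w(x := s)) =
    pmf (\<theta> x (restrict w (parents G x))) s * joint A G \<theta> w"
proof -
  have "restrict (w(x := s)) (parents G x) = restrict w (parents G x)"
    using assms by (intro restrict_ext) auto
  moreover have "joint A G \<theta> (w(x := s)) = joint A G \<theta> w"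
    using assms by (intro joint_cong_parents) auto
  moreover have "finite A"
    using assms(1) finite_nodes by (rule finite_subset)
  ultimately show ?thesis
    using assms(3) by (simp add: joint_def)
qed

text \<open>A finite acyclic relation is well-founded, and a minimal node outside \<open>A\<close>
  has all its parents in \<open>A\<close>. Parent-closed sets can thus grow by one node at a
  time.\<close>

lemma obtain_minimal_node:
  assumes "A \<subset> U"
  obtains x where "x \<in> U" "x \<notin> A" "parents G x \<subseteq> A"
proof -
  have "G \<subseteq> U \<times> U" "acyclic G"
    using dag by (auto simp: dag_def)
  then have "wf G"
    using finite_nodes by (meson finite_SigmaI finite_acyclic_wf finite_subset)
  moreover obtain y where "y \<in> U - A"
    using assms by blast
  ultimately obtain x where "x \<in> U - A" "\<And>y. (y, x) \<in> G \<Longrightarrow> y \<notin> U - A"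
    by (rule wfE_min) blast
  with parents_subset[of x] that show thesis
    by (auto simp: parents_def)
qed

text \<open>Induction on the number of nodes outside \<open>A\<close>. Pick a minimal one,
  \<open>x\<close>: the marginal on \<open>A\<close> is the sum over the states of \<open>x\<close>
  of the marginal on \<open>insert x A\<close>. The latter factorises by the induction hypothesis,
  and the factor of \<open>x\<close> sums to 1.\<close>

lemma marginal_joint:
  assumes "bayes_net U S G \<theta>"
    and "A \<subseteq> U" "\<And>y. y \<in> A \<Longrightarrow> parents G y \<subseteq> A" "w \<in> Pi\<^sub>E A S"
  shows "marginal U S (joint U G \<theta>) A w = joint A G \<theta> w"
  using assms(2-)
proof (induction "card (U - A)" arbitrary: A w)
  case 0
  then have "A = U"
    using finite_nodes by auto
  with 0 have "{u \<in> Pi\<^sub>E U S. restrict u A = w} = {w}"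
    by (auto simp: PiE_restrict)
  with \<open>A = U\<close> show ?case
    by (simp add: marginal_def)
next
  case (Suc n)
  then have "A \<subset> U"
    by (metis Diff_cancel card.empty nat.distinct(1) psubsetI)
  then obtain x where x: "x \<in> U" "x \<notin> A" "parents G x \<subseteq> A"
    by (rule obtain_minimal_node)
  have w: "restrict w (parents G x) \<in> Pi\<^sub>E (parents G x) S"
    using Suc.prems(3) x(3) by (auto simp: PiE_def Pi_def)
  have "marginal U S (joint U G \<theta>) A w =
      (\<Sum>s\<in>S x. \<Sum>u\<in>{u. u \<in> {u \<in> Pi\<^sub>E U S. restrict u A = w} \<and> u x = s}. joint U G \<theta> u)"
    unfolding marginal_def
    using finite_assignments finite_states[OF x(1)] x(1) by (subst sum.group) auto
  also have "\<dots> = (\<Sum>s\<in>S x. marginal U S (joint U G \<theta>) (insert x A) (w(x := s)))"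
  proof -
    \<comment> \<open>Since \<open>x\<close> lies outside \<open>A\<close> and \<open>w\<close> is
      extensional on \<open>A\<close>, prescribing the restriction to \<open>A\<close> and the value
      at \<open>x\<close> amounts to prescribing the restriction to
      \<open>insert x A\<close>.\<close>
    have "(u \<in> Pi\<^sub>E U S \<and> restrict u A = w) \<and> u x = s \<longleftrightarrow>
        u \<in> Pi\<^sub>E U S \<and> restrict u (insert x A) = w(x := s)" for u s
    proof -
      have "restrict u A = w \<and> u x = s \<longleftrightarrow> restrict u (insert x A) = w(x := s)"
        using x(2) Suc.prems(3) by (auto simp: fun_eq_iff restrict_def PiE_def extensional_def)
      then show ?thesis by blast
    qed
    then show ?thesis
      by (simp add: marginal_def)
  qed
  also have "\<dots> = (\<Sum>s\<in>S x. joint (insert x A) G \<theta> (w(x := s)))"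
  proof (intro sum.cong refl Suc.hyps(1))
    have "U - insert x A = (U - A) - {x}"
      by auto
    then show "n = card (U - insert x A)"
      using Suc.hyps(2) x finite_nodes by simp
    show "w(x := s) \<in> Pi\<^sub>E (insert x A) S" if "s \<in> S x" for s
      using that Suc.prems(3) by (rule PiE_fun_upd)
  qed (use Suc.prems x in auto)
  also have "\<dots> = (\<Sum>s\<in>S x. pmf (\<theta> x (restrict w (parents G x))) s) * joint A G \<theta> w"
    by (simp add: joint_insert Suc.prems x sum_distrib_right)
  also have "\<dots> = joint A G \<theta> w"
    by (simp add: sum_bayes_net[OF assms(1) x(1) w])
  finally show ?case .
qed

section \<open>Reference states and the index set of the coordinates\<close>

definition ref :: "'v \<Rightarrow> 's" where
  "ref x = (SOME s. s \<in> S x)"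

lemma ref_state: "x \<in> U \<Longrightarrow> ref x \<in> S x"
  unfolding ref_def using states_nonempty by (simp add: some_in_eq)

text \<open>Any parent state \<open>c\<close> and state \<open>s\<close> occur together in some full
  assignment, and the parameter in question is a factor of the positive joint value there.\<close>

lemma pmf_pos_of_joint_pos:
  assumes "\<forall>u\<in>Pi\<^sub>E U S. 0 < joint U G \<theta> u"
    and "x \<in> U" "c \<in> Pi\<^sub>E (parents G x) S" "s \<in> S x"
  shows "0 < pmf (\<theta> x c) s"
proof -
  \<comment> \<open>The prescriptions \<open>c\<close> and \<open>s\<close> cannot clash, because
    acyclicity prevents \<open>x\<close> from being its own parent. Reference states fill the
    remaining nodes.\<close>
  define u where "u = (\<lambda>y\<in>U. if y \<in> parents G x then c y else if y = x then s else ref y)"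
  have "x \<notin> parents G x"
    using dag by (auto simp: parents_def dag_def acyclic_def)
  then have ux: "u x = s"
    using assms(2) by (simp add: u_def)
  have uc: "restrict u (parents G x) = c"
    using assms(3) parents_subset[of x] by (auto simp: u_def fun_eq_iff restrict_def PiE_def extensional_def)
  have "u \<in> Pi\<^sub>E U S"
    using assms ref_state by (auto simp: u_def)
  then have "joint U G \<theta> u \<noteq> 0"
    using assms(1) by force
  then have "pmf (\<theta> x (restrict u (parents G x))) (u x) \<noteq> 0"
    using assms(2) finite_nodes by (auto simp: joint_def)
  then show ?thesis
    by (simp add: ux uc pmf_pos)
qed

text \<open>Omitting the reference state accounts for the normalisation of each conditional
  distribution and yields the factor \<open>card (S x) - 1\<close> of
  \<open>node_dim\<close>.\<close>

definition coords :: "('v \<times> ('v \<Rightarrow> 's) \<times> 's) set" where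
  "coords = (SIGMA x:U. Pi\<^sub>E (parents G x) S \<times> (S x - {ref x}))"

lemma finite_coords: "finite coords"
  unfolding coords_def
  using finite_nodes finite_states parents_subset
  by (intro finite_SigmaI finite_cartesian_product finite_PiE) (auto intro: finite_subset)

lemma card_coords: "card coords = net_dim U S G"
proof -
  have fin: "finite (parents G x)" for x
    using parents_subset finite_nodes by (rule finite_subset)
  have "card coords = (\<Sum>x\<in>U. card (Pi\<^sub>E (parents G x) S \<times> (S x - {ref x})))"
    unfolding coords_def using finite_nodes finite_states parents_subset fin
    by (intro card_SigmaI ballI finite_cartesian_product finite_PiE) auto
  also have "\<dots> = (\<Sum>x\<in>U. node_dim S x (parents G x))"
    by (intro sum.cong refl)
      (simp add: node_dim_def card_cartesian_product card_PiE fin ref_state finite_states)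
  finally show ?thesis
    by (simp add: net_dim_def)
qed

section \<open>Log-odds recovered from ancestral marginals\<close>

definition ancestors :: "'v \<Rightarrow> 'v set" where
  "ancestors x = {y. (y, x) \<in> G\<^sup>+}"

lemma ancestors_subset: "ancestors x \<subseteq> U"
  using dag trancl_subset_Sigma[of G U] by (auto simp: ancestors_def dag_def)

lemma parents_subset_ancestors: "parents G x \<subseteq> ancestors x"
  by (auto simp: parents_def ancestors_def)

lemma parents_ancestors: "y \<in> ancestors x \<Longrightarrow> parents G y \<subseteq> ancestors x"
  by (auto simp: parents_def ancestors_def)

lemma not_own_ancestor: "x \<notin> ancestors x"
  using dag by (auto simp: ancestors_def dag_def acyclic_def)

text \<open>The parents of \<open>x\<close> need not form a parent-closed set, so \<open>c\<close>
  is completed to all ancestors. The choice of reference states for the rest is harmless: given its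
  ancestors, \<open>x\<close> depends only on its parents.\<close>

definition ancestral_extension :: "'v \<Rightarrow> ('v \<Rightarrow> 's) \<Rightarrow> 'v \<Rightarrow> 's" where
  "ancestral_extension x c = (\<lambda>y\<in>ancestors x. if y \<in> parents G x then c y else ref y)"

lemma ancestral_extension_PiE:
  "c \<in> Pi\<^sub>E (parents G x) S \<Longrightarrow> ancestral_extension x c \<in> Pi\<^sub>E (ancestors x) S"
  using ref_state subsetD[OF ancestors_subset]
  by (auto simp: ancestral_extension_def dest: PiE_mem)

lemma restrict_ancestral_extension:
  "c \<in> Pi\<^sub>E (parents G x) S \<Longrightarrow> restrict (ancestral_extension x c) (parents G x) = c"
  using parents_subset_ancestors
  by (auto simp: ancestral_extension_def fun_eq_iff restrict_def PiE_def extensional_def)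

text \<open>As a function of \<open>s\<close>, this is an unnormalised conditional distribution of
  \<open>x\<close> given \<open>c\<close>. It is computed from \<open>p\<close> alone, as a finite
  sum of values of \<open>p\<close>, which later yields continuity.\<close>

definition family_weight :: "(('v \<Rightarrow> 's) \<Rightarrow> real) \<Rightarrow> 'v \<Rightarrow> ('v \<Rightarrow> 's) \<Rightarrow> 's \<Rightarrow> real" where
  "family_weight p x c s =
     marginal U S p (insert x (ancestors x)) ((ancestral_extension x c)(x := s))"

definition log_odds :: "(('v \<Rightarrow> 's) \<Rightarrow> real) \<Rightarrow> 'v \<times> ('v \<Rightarrow> 's) \<times> 's \<Rightarrow> real" where
  "log_odds p =
     (\<lambda>(x, c, s)\<in>coords. ln (family_weight p x c s) - ln (family_weight p x c (ref x)))"

text \<open>The set \<open>insert x (ancestors x)\<close> is parent-closed, so its marginal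
  factorises. The factor besides the parameter does not depend on \<open>s\<close> and cancels in
  odds.\<close>

lemma family_weight_joint:
  assumes "bayes_net U S G \<theta>" "x \<in> U" "c \<in> Pi\<^sub>E (parents G x) S" "s \<in> S x"
  shows "family_weight (restrict (joint U G \<theta>) (Pi\<^sub>E U S)) x c s =
    pmf (\<theta> x c) s * joint (ancestors x) G \<theta> (ancestral_extension x c)"
proof -
  let ?w = "ancestral_extension x c"
  have "family_weight (restrict (joint U G \<theta>) (Pi\<^sub>E U S)) x c s =
      marginal U S (joint U G \<theta>) (insert x (ancestors x)) (?w(x := s))"
    \<comment> \<open>The sum in \<open>marginal\<close> runs over elements of
      \<open>Pi\<^sub>E U S\<close> only, where the restriction has no effect.\<close>
    unfolding family_weight_def marginal_def by (intro sum.cong) auto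
  also have "\<dots> = joint (insert x (ancestors x)) G \<theta> (?w(x := s))"
  proof (rule marginal_joint[OF assms(1)])
    show "?w(x := s) \<in> Pi\<^sub>E (insert x (ancestors x)) S"
      using assms(4) ancestral_extension_PiE[OF assms(3)] by (rule PiE_fun_upd)
  qed (use assms(2) ancestors_subset parents_subset_ancestors parents_ancestors in blast)+
  also have "\<dots> = pmf (\<theta> x (restrict ?w (parents G x))) s * joint (ancestors x) G \<theta> ?w"
    by (intro joint_insert ancestors_subset parents_ancestors not_own_ancestor
        parents_subset_ancestors)
  finally show ?thesis
    by (simp add: restrict_ancestral_extension[OF assms(3)])
qed

lemma joint_ancestors_pos:
  assumes "\<forall>u\<in>Pi\<^sub>E U S. 0 < joint U G \<theta> u" and "w \<in> Pi\<^sub>E (ancestors x) S"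
  shows "0 < joint (ancestors x) G \<theta> w"
  unfolding joint_def
proof (rule prod_pos)
  fix y assume y: "y \<in> ancestors x"
  have "restrict w (parents G y) \<in> Pi\<^sub>E (parents G y) S"
    using assms(2) parents_ancestors[OF y] by (auto simp: PiE_def Pi_def)
  then show "0 < pmf (\<theta> y (restrict w (parents G y))) (w y)"
    using y assms ancestors_subset[of x] by (intro pmf_pos_of_joint_pos) auto
qed

lemma family_weight_pos:
  assumes "p \<in> positive_laws U S G" "x \<in> U" "c \<in> Pi\<^sub>E (parents G x) S" "s \<in> S x"
  shows "0 < family_weight p x c s"
proof -
  obtain \<theta> where \<theta>: "p = restrict (joint U G \<theta>) (Pi\<^sub>E U S)" "bayes_net U S G \<theta>"
    "\<forall>u\<in>Pi\<^sub>E U S. 0 < joint U G \<theta> u"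
    using assms(1) by (auto simp: positive_laws_def)
  then show ?thesis
    using assms(2-)
    by (simp add: family_weight_joint pmf_pos_of_joint_pos joint_ancestors_pos
        ancestral_extension_PiE)
qed

text \<open>The common factor over the ancestors is positive and cancels in the difference of
  logarithms.\<close>

lemma log_odds_joint:
  assumes "bayes_net U S G \<theta>" "\<forall>u\<in>Pi\<^sub>E U S. 0 < joint U G \<theta> u" "(x, c, s) \<in> coords"
  shows "log_odds (restrict (joint U G \<theta>) (Pi\<^sub>E U S)) (x, c, s) =
    ln (pmf (\<theta> x c) s / pmf (\<theta> x c) (ref x))"
proof -
  have x: "x \<in> U" "c \<in> Pi\<^sub>E (parents G x) S" "s \<in> S x" "ref x \<in> S x"
    using assms(3) ref_state by (auto simp: coords_def)
  note pos = pmf_pos_of_joint_pos[OF assms(2) x(1,2)]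
    joint_ancestors_pos[OF assms(2) ancestral_extension_PiE[OF x(2)]]
  show ?thesis
    using assms(3) pos(1)[OF x(3)] pos(1)[OF x(4)] pos(2)
    by (simp add: log_odds_def family_weight_joint[OF assms(1) x(1,2)] x ln_mult ln_div)
qed

section \<open>The softmax parametrisation\<close>

definition odds :: "('v \<times> ('v \<Rightarrow> 's) \<times> 's \<Rightarrow> real) \<Rightarrow> 'v \<Rightarrow> ('v \<Rightarrow> 's) \<Rightarrow> 's \<Rightarrow> real" where
  "odds a x c s = (if s = ref x then 1 else exp (a (x, c, s)))"

text \<open>The reference state has no coordinate in \<open>a\<close>; its odds relative to itself
  are 1. The function is set to 0 outside \<open>S x\<close> because \<open>embed_pmf\<close> takes
  a function on the whole type of states.\<close>

definition softmax ::
  "('v \<times> ('v \<Rightarrow> 's) \<times> 's \<Rightarrow> real) \<Rightarrow> 'v \<Rightarrow> ('v \<Rightarrow> 's) \<Rightarrow> 's pmf" where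
  "softmax a x c =
     embed_pmf (\<lambda>s. if s \<in> S x then odds a x c s / (\<Sum>t\<in>S x. odds a x c t) else 0)"

lemma odds_pos: "0 < odds a x c s"
  by (simp add: odds_def)

lemma sum_odds_pos: "x \<in> U \<Longrightarrow> 0 < (\<Sum>t\<in>S x. odds a x c t)"
  using finite_states states_nonempty odds_pos by (intro sum_pos) auto

lemma pmf_softmax:
  assumes "x \<in> U"
  shows "pmf (softmax a x c) s =
    (if s \<in> S x then odds a x c s / (\<Sum>t\<in>S x. odds a x c t) else 0)"
  unfolding softmax_def
proof (rule pmf_embed_pmf)
  let ?f = "\<lambda>s. if s \<in> S x then odds a x c s / (\<Sum>t\<in>S x. odds a x c t) else 0"
  show nonneg: "0 \<le> ?f s" for s
    using sum_odds_pos[OF assms, of a c] odds_pos[of a x c s] by simp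
  \<comment> \<open>The integrand vanishes outside the finite set \<open>S x\<close>, so the
    integral is a finite sum.\<close>
  have "(\<integral>\<^sup>+s. ennreal (?f s) \<partial>count_space UNIV) = (\<Sum>s\<in>S x. ennreal (?f s))"
    using finite_states[OF assms] by (intro nn_integral_count_space') auto
  also have "\<dots> = ennreal (\<Sum>s\<in>S x. ?f s)"
    using nonneg by (intro sum_ennreal)
  also have "(\<Sum>s\<in>S x. ?f s) = (\<Sum>s\<in>S x. odds a x c s) / (\<Sum>t\<in>S x. odds a x c t)"
    unfolding sum_divide_distrib by (intro sum.cong) auto
  also have "\<dots> = 1"
    using sum_odds_pos[OF assms, of a c] by (intro divide_self) simp
  finally show "(\<integral>\<^sup>+s. ennreal (?f s) \<partial>count_space UNIV) = 1"
    by simp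
qed

lemma bayes_net_softmax: "bayes_net U S G (softmax a)"
  unfolding bayes_net_iff by (auto simp: set_pmf_eq pmf_softmax)

lemma joint_softmax_pos: "u \<in> Pi\<^sub>E U S \<Longrightarrow> 0 < joint U G (softmax a) u"
  unfolding joint_def
  by (intro prod_pos) (auto simp: pmf_softmax odds_pos sum_odds_pos)

definition softmax_law :: "('v \<times> ('v \<Rightarrow> 's) \<times> 's \<Rightarrow> real) \<Rightarrow> ('v \<Rightarrow> 's) \<Rightarrow> real" where
  "softmax_law a = restrict (joint U G (softmax a)) (Pi\<^sub>E U S)"

lemma softmax_law_positive: "softmax_law a \<in> positive_laws U S G"
  unfolding softmax_law_def positive_laws_def
  using bayes_net_softmax joint_softmax_pos by blast

text \<open>The normalising sum cancels in the ratio to the reference state and leaves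
  \<open>exp (a i)\<close>. Outside \<open>coords\<close> both sides are undefined by
  extensionality.\<close>

lemma log_odds_softmax_law:
  assumes "a \<in> extensional coords"
  shows "log_odds (softmax_law a) = a"
proof (rule extensionalityI[where A = coords])
  show "log_odds (softmax_law a) \<in> extensional coords"
    by (simp add: log_odds_def)
  fix i assume "i \<in> coords"
  then obtain x c s where i: "i = (x, c, s)" "(x, c, s) \<in> coords"
    by (cases i) auto
  then have x: "x \<in> U" "s \<in> S x" "s \<noteq> ref x"
    by (auto simp: coords_def)
  have "log_odds (softmax_law a) i =
      ln (pmf (softmax a x c) s / pmf (softmax a x c) (ref x))"
    unfolding softmax_law_def i(1)
    using i(2) by (intro log_odds_joint bayes_net_softmax) (simp_all add: joint_softmax_pos)
  also have "\<dots> = a i"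
    using x sum_odds_pos[OF x(1), of a c] by (simp add: pmf_softmax ref_state odds_def i(1))
  finally show "log_odds (softmax_law a) i = a i" .
qed (use assms in auto)

text \<open>The odds are the parameters divided by that of the reference state. As the parameters
  sum to 1, normalising the odds gives them back.\<close>

lemma softmax_law_log_odds:
  assumes "p \<in> positive_laws U S G"
  shows "softmax_law (log_odds p) = p"
proof -
  obtain \<theta> where \<theta>: "p = restrict (joint U G \<theta>) (Pi\<^sub>E U S)" "bayes_net U S G \<theta>"
    "\<forall>u\<in>Pi\<^sub>E U S. 0 < joint U G \<theta> u"
    using assms by (auto simp: positive_laws_def)
  have eq: "pmf (softmax (log_odds p) x c) s = pmf (\<theta> x c) s"
    if x: "x \<in> U" "c \<in> Pi\<^sub>E (parents G x) S" "s \<in> S x" for x c s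
  proof -
    have pos: "0 < pmf (\<theta> x c) t" if "t \<in> S x" for t
      using \<theta>(3) x(1,2) that by (rule pmf_pos_of_joint_pos)
    have ratio: "odds (log_odds p) x c t = pmf (\<theta> x c) t / pmf (\<theta> x c) (ref x)"
      if "t \<in> S x" for t
    proof (cases "t = ref x")
      case True
      then show ?thesis
        using pos[OF that] by (simp add: odds_def)
    next
      case False
      then have "(x, c, t) \<in> coords"
        using x that by (simp add: coords_def)
      then show ?thesis
        using False pos[OF that] pos[OF ref_state[OF x(1)]]
        by (simp add: odds_def \<theta>(1) log_odds_joint[OF \<theta>(2,3)])
    qed
    have "(\<Sum>t\<in>S x. odds (log_odds p) x c t) = 1 / pmf (\<theta> x c) (ref x)"
      using ratio sum_bayes_net[OF \<theta>(2) x(1,2)] by (simp flip: sum_divide_distrib)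
    then show ?thesis
      using x(1,3) ratio[OF x(3)] pos[OF ref_state[OF x(1)]] by (simp add: pmf_softmax)
  qed
  \<comment> \<open>At an assignment \<open>u\<close>, only admissible parent states and states of
    nodes are read, so \<open>eq\<close> covers every factor.\<close>
  have "joint U G (softmax (log_odds p)) u = joint U G \<theta> u" if u: "u \<in> Pi\<^sub>E U S" for u
    unfolding joint_def
  proof (intro prod.cong refl eq)
    show "restrict u (parents G x) \<in> Pi\<^sub>E (parents G x) S" for x
      using u parents_subset[of x] by (auto simp: PiE_def Pi_def)
  qed (use u in auto)
  then show ?thesis
    unfolding softmax_law_def \<theta>(1) by (intro restrict_ext) (simp add: \<theta>(1))
qed

section \<open>Continuity of both coordinate changes\<close>

lemma continuous_map_softmax_law:
  "continuous_map (powertop_real coords)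
     (subtopology (powertop_real (Pi\<^sub>E U S)) (positive_laws U S G)) softmax_law"
proof (rule continuous_map_into_subtopology)
  \<comment> \<open>The odds are constant at the reference state and the exponential of a projection
    elsewhere. Joint values arise from them by finite sums, products and quotients with positive
    denominators.\<close>
  have odds: "continuous_map (powertop_real coords) euclideanreal (\<lambda>a. odds a x c s)"
    if "x \<in> U" "c \<in> Pi\<^sub>E (parents G x) S" "s \<in> S x" for x c s
  proof (cases "s = ref x")
    case False
    with that have "(x, c, s) \<in> coords"
      by (simp add: coords_def)
    then have "continuous_map (powertop_real coords) euclideanreal (exp \<circ> (\<lambda>a. a (x, c, s)))"
      by (intro continuous_map_compose[of _ euclideanreal] continuous_map_product_projection)
        (auto intro: continuous_intros)
    with False show ?thesis
      by (simp add: odds_def comp_def)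
  qed (simp add: odds_def)
  have "continuous_map (powertop_real coords) euclideanreal (\<lambda>a. joint U G (softmax a) u)"
    if u: "u \<in> Pi\<^sub>E U S" for u
    unfolding joint_def
  proof (intro continuous_map_prod finite_nodes)
    fix x assume x: "x \<in> U"
    let ?c = "restrict u (parents G x)"
    have c: "?c \<in> Pi\<^sub>E (parents G x) S"
      using u parents_subset[of x] by (auto simp: PiE_def Pi_def)
    have "u x \<in> S x"
      using u x by auto
    then have "(\<lambda>a. pmf (softmax a x ?c) (u x)) =
        (\<lambda>a. odds a x ?c (u x) / (\<Sum>t\<in>S x. odds a x ?c t))"
      by (simp add: pmf_softmax x)
    moreover have "(\<Sum>t\<in>S x. odds a x ?c t) \<noteq> 0" for a
      using sum_odds_pos[OF x, of a ?c] by simp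
    ultimately show "continuous_map (powertop_real coords) euclideanreal
        (\<lambda>a. pmf (softmax a x ?c) (u x))"
      using x c \<open>u x \<in> S x\<close> finite_states
      by (auto intro!: continuous_map_real_divide continuous_map_sum odds)
  qed
  then show "continuous_map (powertop_real coords) (powertop_real (Pi\<^sub>E U S)) softmax_law"
    unfolding continuous_map_componentwise softmax_law_def by auto
  show "softmax_law \<in> topspace (powertop_real coords) \<rightarrow> positive_laws U S G"
    using softmax_law_positive by blast
qed

lemma continuous_map_log_odds:
  "continuous_map (subtopology (powertop_real (Pi\<^sub>E U S)) (positive_laws U S G))
     (powertop_real coords) log_odds"
proof -
  let ?P = "subtopology (powertop_real (Pi\<^sub>E U S)) (positive_laws U S G)"
  have ln_weight: "continuous_map ?P euclideanreal (\<lambda>p. ln (family_weight p x c s))"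
    if "x \<in> U" "c \<in> Pi\<^sub>E (parents G x) S" "s \<in> S x" for x c s
  proof -
    have "continuous_map ?P euclideanreal (\<lambda>p. family_weight p x c s)"
      unfolding family_weight_def marginal_def using finite_assignments
      by (intro continuous_map_sum continuous_map_from_subtopology
          continuous_map_product_projection) auto
    \<comment> \<open>The codomain is narrowed to the positive reals, on which \<open>ln\<close> is
      continuous; positivity of the laws makes this possible.\<close>
    then have "continuous_map ?P (top_of_set {0<..}) (\<lambda>p. family_weight p x c s)"
      using that by (auto simp: continuous_map_in_subtopology family_weight_pos)
    moreover have "continuous_map (top_of_set {0<..}) euclideanreal (ln :: real \<Rightarrow> real)"
      by (auto intro!: continuous_intros)
    ultimately have "continuous_map ?P euclideanreal (ln \<circ> (\<lambda>p. family_weight p x c s))"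
      by (rule continuous_map_compose)
    then show ?thesis
      by (simp only: comp_def)
  qed
  have "continuous_map ?P euclideanreal (\<lambda>p. log_odds p i)" if "i \<in> coords" for i
  proof -
    obtain x c s where i: "i = (x, c, s)"
      by (cases i)
    with that have "x \<in> U" "c \<in> Pi\<^sub>E (parents G x) S" "s \<in> S x"
      by (auto simp: coords_def)
    then show ?thesis
      using that i by (auto simp: log_odds_def intro!: continuous_map_diff ln_weight ref_state)
  qed
  then show ?thesis
    by (auto simp: continuous_map_componentwise log_odds_def)
qed

section \<open>The space of positive laws and its dimension\<close>

lemma positive_laws_homeomorphic_Euclidean_space:
  "subtopology (powertop_real (Pi\<^sub>E U S)) (positive_laws U S G)
     homeomorphic_space Euclidean_space (net_dim U S G)"
proof -
  let ?P = "subtopology (powertop_real (Pi\<^sub>E U S)) (positive_laws U S G)"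
  have "homeomorphic_maps ?P (powertop_real coords) log_odds softmax_law"
    unfolding homeomorphic_maps_def
  proof (intro conjI ballI continuous_map_log_odds continuous_map_softmax_law)
    fix p assume "p \<in> topspace ?P"
    then show "softmax_law (log_odds p) = p"
      by (intro softmax_law_log_odds) simp
  next
    fix a assume "a \<in> topspace (powertop_real coords)"
    \<comment> \<open>Points of a product space are extensional functions, as
      \<open>log_odds_softmax_law\<close> requires.\<close>
    then show "log_odds (softmax_law a) = a"
      by (intro log_odds_softmax_law) (simp add: PiE_def)
  qed
  then have "?P homeomorphic_space powertop_real coords"
    by (auto simp: homeomorphic_space_def)
  also have "powertop_real coords homeomorphic_space Euclidean_space (net_dim U S G)"
    using homeomorphic_powertop_real_Euclidean_space[OF finite_coords] by (simp only: card_coords)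
  finally (homeomorphic_space_trans) show ?thesis .
qed

end

theorem theorem3:
  fixes U :: "'v set" and S :: "'v \<Rightarrow> 's set" and G G' :: "('v \<times> 'v) set"
  assumes "finite U"
    and "\<And>x. x \<in> U \<Longrightarrow> finite (S x) \<and> card (S x) \<ge> 2"
    and "dag U G" and "dag U G'"
    and "dag_equiv U S G G'"
  shows "net_dim U S G = net_dim U S G'"
proof -
  have "S x \<noteq> {}" if "x \<in> U" for x
    using assms(2)[OF that] by auto
  then interpret G: finite_state_dag U S G + G': finite_state_dag U S G'
    by unfold_locales (simp_all add: assms)
  \<comment> \<open>The ambient space \<open>powertop_real (Pi\<^sub>E U S)\<close> does not mention
    the dag, and the sets of positive laws coincide. So one and the same space is homeomorphic to
    both Euclidean spaces.\<close>
  have "Euclidean_space (net_dim U S G) homeomorphic_space Euclidean_space (net_dim U S G')"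
    using G.positive_laws_homeomorphic_Euclidean_space
      G'.positive_laws_homeomorphic_Euclidean_space
      dag_equiv_positive_laws[OF assms(5)] homeomorphic_space_sym homeomorphic_space_trans
    by metis
  then show ?thesis
    by (simp add: invariance_of_dimension_Euclidean_space)
qed

end
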